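(* Let $G$ be a connected graph of order $n\ge 2$ with $V(G)=\{u_1,\ldots,u_n\}$, let $\mathcal{H}=\{H_1,\ldots,H_n\}$ be a family of $n$ non-trivial graphs, and let $k\in\{1,\ldots,\min\{\mathcal{T}(G\circ\mathcal{H}),\mathcal{C}(\mathcal{H})\}\}$. (i) If $(G,\mathcal{H},k)$ satisfies Properties $\mathcal{P}_1$ and $\mathcal{P}_2$, then $\dim_k(G\circ\mathcal{H})=\sum_{i=1}^n\operatorname{adim}_k(H_i)$. (ii) If $(G,\mathcal{H},k)$ satisfies Properties $\mathcal{P}_3$ and $\mathcal{P}_4$, then $\dim_k(G\circ\overline{\mathcal{H}})=\sum_{i=1}^n\operatorname{adim}_k(H_i)$, where $\overline{\mathcal{H}}=\{\overline{H}_1,\ldots,\overline{H}_n\}$.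
   Context: Graphs are finite and simple; non-trivial means at least two vertices; $\delta,\Delta$ are minimum/maximum degree. Lexicographic product $G\circ\mathcal{H}$: vertex set $\bigcup_i\{u_i\}\times V(H_i)$, with $(u_i,v)\sim(u_j,w)$ iff $u_iu_j\in E(G)$, or $i=j$ and $vw\in E(H_i)$. For connected $X$, $S\subseteq V(X)$ is a $k$-metric generator if every two distinct vertices $x,y$ admit at least $k$ vertices $w\in S$ with $d_X(x,w)\neq d_X(y,w)$; $\dim_k(X)$ is its minimum cardinality. For a graph $H$, $S$ is a $k$-adjacency generator if every two distinct $x,y$ satisfy $|((N_H(x)\triangledown N_H(y))\cup\{x,y\})\cap S|\ge k$; $\operatorname{adim}_k(H)$ is its minimum cardinality and a $k$-adjacency basis is one of that cardinality. $\mathcal{C}(H)=\min_{x\neq y}|(N_H(x)\triangledown N_H(y))\cup\{x,y\}|$, $\mathcal{C}(\mathcal{H})=\min_i\mathcal{C}(H_i)$. Twins in $G$: distinct $x,y$ are true twins if $N[x]=N[y]$, false twins if $N(x)=N(y)$; the relation $N(x)-\{y\}=N(y)-\{x\}$ partitions $V(G)$ into singleton, false twin and true twin classes with unions $S(G),FT(G),TT(G)$; $FT(u_i)$, $TT(u_i)$ is the class of $u_i$. $\mathcal{T}(u_i,\mathcal{H})=|V(H_i)|$ if $u_i\in S(G)$; $=\min\{\delta(H_j)+\delta(H_l)+2: u_j,u_l\in FT(u_i), j\neq l\}$ if $u_i\in FT(G)$; $=\min\{|V(H_j)|-\Delta(H_j)+|V(H_l)|-\Delta(H_l): u_j,u_l\in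 TT(u_i), j\neq l\}$ if $u_i\in TT(G)$; $\mathcal{T}(G\circ\mathcal{H})=\min_{u_i}\mathcal{T}(u_i,\mathcal{H})$. Properties of $(G,\mathcal{H},k)$: $\mathcal{P}_1$: for every $u_i\in TT(G)$ with $TT(u_i)=\{u_{i_1},\ldots,u_{i_r}\}$ there exist $k$-adjacency bases $A_{i_1},\ldots,A_{i_r}$ of $H_{i_1},\ldots,H_{i_r}$ such that for all $j\neq l$, all $x\in V(H_{i_j})$, $y\in V(H_{i_l})$: $|(A_{i_j}\cap(V(H_{i_j})-N_{H_{i_j}}(x)))\cup(A_{i_l}\cap(V(H_{i_l})-N_{H_{i_l}}(y)))|\ge k$. $\mathcal{P}_2$: for every $u_i\in FT(G)$ with $FT(u_i)=\{u_{i_1},\ldots,u_{i_r}\}$, there exist such bases with $|(A_{i_j}\cap N_{H_{i_j}}[x])\cup(A_{i_l}\cap N_{H_{i_l}}[y])|\ge k$. $\mathcal{P}_3$: as $\mathcal{P}_1$ (over $TT(G)$) with $|(A_{i_j}\cap N_{H_{i_j}}(x))\cup(A_{i_l}\cap N_{H_{i_l}}(y))|\ge k$. $\mathcal{P}_4$: as $\mathcal{P}_2$ (over $FT(G)$) with $|(A_{i_j}\cap(V(H_{i_j})-N_{H_{i_j}}(x)))\cup(A_{i_l}\cap(V(H_{i_l})-N_{H_{i_l}}(y)))|\ge k$. *)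

theory Defs
  imports "Graph_Theory.Graph_Theory"
begin

text \<open>
  Finite simple graphs are the digraphs satisfying the library locale \<^locale>\<open>pair_graph\<close>
  (finite, loop-free, symmetric arcs given as pairs of vertices).
\<close>

definition nbhd :: "'a pair_pre_digraph \<Rightarrow> 'a \<Rightarrow> 'a set" where
  "nbhd G x = {y. (x, y) \<in> parcs G}"

definition closed_nbhd :: "'a pair_pre_digraph \<Rightarrow> 'a \<Rightarrow> 'a set" where
  "closed_nbhd G x = insert x (nbhd G x)"

definition non_nbhd :: "'a pair_pre_digraph \<Rightarrow> 'a \<Rightarrow> 'a set" where
  "non_nbhd G x = pverts G - nbhd G x"

text \<open>As arcs are symmetric, the degree of a vertex is its out-degree.\<close>

definition min_degree :: "'a pair_pre_digraph \<Rightarrow> nat" where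
  "min_degree G = Min (out_degree (with_proj G) ` pverts G)"

definition max_degree :: "'a pair_pre_digraph \<Rightarrow> nat" where
  "max_degree G = Max (out_degree (with_proj G) ` pverts G)"

definition gcomplement :: "'a pair_pre_digraph \<Rightarrow> 'a pair_pre_digraph" where
  "gcomplement G = \<lparr>pverts = pverts G,
     parcs = {(x, y). x \<in> pverts G \<and> y \<in> pverts G \<and> x \<noteq> y \<and> (x, y) \<notin> parcs G}\<rparr>"

text \<open>
  A family of graphs with one member for every vertex of \<open>G\<close> is indexed by the vertices
  themselves: \<open>H u\<close> is the graph substituted for \<open>u\<close>.
\<close>

definition lex_product ::
  "'a pair_pre_digraph \<Rightarrow> ('a \<Rightarrow> 'b pair_pre_digraph) \<Rightarrow> ('a \<times> 'b) pair_pre_digraph" where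
  "lex_product G H = \<lparr>pverts = (SIGMA u:pverts G. pverts (H u)),
     parcs = {((u, v), (u', w)).
       u \<in> pverts G \<and> v \<in> pverts (H u) \<and> u' \<in> pverts G \<and> w \<in> pverts (H u') \<and>
       ((u, u') \<in> parcs G \<or> u = u' \<and> (v, w) \<in> parcs (H u))}\<rparr>"

definition gdist :: "'a pair_pre_digraph \<Rightarrow> 'a \<Rightarrow> 'a \<Rightarrow> ereal" where
  "gdist X x y = wf_digraph.\<mu> (with_proj X) (\<lambda>_. 1) x y"


section \<open>Metric and adjacency generators\<close>

definition metric_generator :: "nat \<Rightarrow> 'a pair_pre_digraph \<Rightarrow> 'a set \<Rightarrow> bool" where
  "metric_generator k X S \<longleftrightarrow> S \<subseteq> pverts X \<and>
     (\<forall>x\<in>pverts X. \<forall>y\<in>pverts X. x \<noteq> y \<longrightarrow>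
        k \<le> card {w \<in> S. gdist X x w \<noteq> gdist X y w})"

text \<open>If there is no generator at all, the two minima below take the junk value \<open>0\<close>.\<close>

definition metric_dim :: "nat \<Rightarrow> 'a pair_pre_digraph \<Rightarrow> nat" where
  "metric_dim k X = Inf (card ` {S. metric_generator k X S})"

definition adj_distinguishers :: "'a pair_pre_digraph \<Rightarrow> 'a \<Rightarrow> 'a \<Rightarrow> 'a set" where
  "adj_distinguishers H x y =
     ((nbhd H x - nbhd H y) \<union> (nbhd H y - nbhd H x)) \<union> {x, y}"

definition adj_generator :: "nat \<Rightarrow> 'a pair_pre_digraph \<Rightarrow> 'a set \<Rightarrow> bool" where
  "adj_generator k H S \<longleftrightarrow> S \<subseteq> pverts H \<and>
     (\<forall>x\<in>pverts H. \<forall>y\<in>pverts H. x \<noteq> y \<longrightarrow> k \<le> card (adj_distinguishers H x y \<inter> S))"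

definition adj_dim :: "nat \<Rightarrow> 'a pair_pre_digraph \<Rightarrow> nat" where
  "adj_dim k H = Inf (card ` {S. adj_generator k H S})"

definition adj_basis :: "nat \<Rightarrow> 'a pair_pre_digraph \<Rightarrow> 'a set \<Rightarrow> bool" where
  "adj_basis k H S \<longleftrightarrow> adj_generator k H S \<and> card S = adj_dim k H"

definition adj_bound :: "'a pair_pre_digraph \<Rightarrow> nat" where
  "adj_bound H = Min {card (adj_distinguishers H x y) | x y.
     x \<in> pverts H \<and> y \<in> pverts H \<and> x \<noteq> y}"

definition adj_bound_family :: "'a set \<Rightarrow> ('a \<Rightarrow> 'b pair_pre_digraph) \<Rightarrow> nat" where
  "adj_bound_family I H = Min ((\<lambda>i. adj_bound (H i)) ` I)"


section \<open>Twin classes\<close>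

definition true_twins :: "'a pair_pre_digraph \<Rightarrow> 'a \<Rightarrow> 'a \<Rightarrow> bool" where
  "true_twins G x y \<longleftrightarrow> x \<noteq> y \<and> closed_nbhd G x = closed_nbhd G y"

definition false_twins :: "'a pair_pre_digraph \<Rightarrow> 'a \<Rightarrow> 'a \<Rightarrow> bool" where
  "false_twins G x y \<longleftrightarrow> x \<noteq> y \<and> nbhd G x = nbhd G y"

definition twin_rel :: "'a pair_pre_digraph \<Rightarrow> 'a rel" where
  "twin_rel G = {(x, y). x \<in> pverts G \<and> y \<in> pverts G \<and> nbhd G x - {y} = nbhd G y - {x}}"

abbreviation twin_class :: "'a pair_pre_digraph \<Rightarrow> 'a \<Rightarrow> 'a set" where
  "twin_class G u \<equiv> twin_rel G `` {u}"

definition singleton_verts :: "'a pair_pre_digraph \<Rightarrow> 'a set" where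
  "singleton_verts G = \<Union>{C \<in> pverts G // twin_rel G. is_singleton C}"

definition false_twin_verts :: "'a pair_pre_digraph \<Rightarrow> 'a set" where
  "false_twin_verts G =
     \<Union>{C \<in> pverts G // twin_rel G. \<not> is_singleton C \<and> pairwise (false_twins G) C}"

definition true_twin_verts :: "'a pair_pre_digraph \<Rightarrow> 'a set" where
  "true_twin_verts G =
     \<Union>{C \<in> pverts G // twin_rel G. \<not> is_singleton C \<and> pairwise (true_twins G) C}"

text \<open>
  For a simple graph the three sets above partition the vertices, so the last branch is
  the true twin case.
\<close>

definition twin_bound_at ::
  "'a pair_pre_digraph \<Rightarrow> ('a \<Rightarrow> 'b pair_pre_digraph) \<Rightarrow> 'a \<Rightarrow> nat" where
  "twin_bound_at G H u =
     (if u \<in> singleton_verts G then card (pverts (H u))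
      else if u \<in> false_twin_verts G then
        Min {min_degree (H j) + min_degree (H l) + 2 | j l.
          j \<in> twin_class G u \<and> l \<in> twin_class G u \<and> j \<noteq> l}
      else
        Min {(card (pverts (H j)) - max_degree (H j)) + (card (pverts (H l)) - max_degree (H l)) | j l.
          j \<in> twin_class G u \<and> l \<in> twin_class G u \<and> j \<noteq> l})"

definition twin_bound :: "'a pair_pre_digraph \<Rightarrow> ('a \<Rightarrow> 'b pair_pre_digraph) \<Rightarrow> nat" where
  "twin_bound G H = Min (twin_bound_at G H ` pverts G)"


section \<open>The four properties\<close>

text \<open>
  The vertex sets of different members of a family are regarded as disjoint. Here they may
  overlap, since all members have vertices in one type, so the two parts of the union are
  tagged with the index.
\<close>

definition compatible_bases ::
  "nat \<Rightarrow> ('a \<Rightarrow> 'b pair_pre_digraph) \<Rightarrow> ('b pair_pre_digraph \<Rightarrow> 'b \<Rightarrow> 'b set) \<Rightarrow> 'a set \<Rightarrow> bool"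
where
  "compatible_bases k H N C \<longleftrightarrow>
     (\<exists>A. (\<forall>i\<in>C. adj_basis k (H i) (A i)) \<and>
       (\<forall>j\<in>C. \<forall>l\<in>C. j \<noteq> l \<longrightarrow>
         (\<forall>x\<in>pverts (H j). \<forall>y\<in>pverts (H l).
            k \<le> card (({j} \<times> (A j \<inter> N (H j) x)) \<union> ({l} \<times> (A l \<inter> N (H l) y))))))"

definition property_P1 ::
  "'a pair_pre_digraph \<Rightarrow> ('a \<Rightarrow> 'b pair_pre_digraph) \<Rightarrow> nat \<Rightarrow> bool" where
  "property_P1 G H k \<longleftrightarrow> (\<forall>u\<in>true_twin_verts G. compatible_bases k H non_nbhd (twin_class G u))"

definition property_P2 ::
  "'a pair_pre_digraph \<Rightarrow> ('a \<Rightarrow> 'b pair_pre_digraph) \<Rightarrow> nat \<Rightarrow> bool" where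
  "property_P2 G H k \<longleftrightarrow> (\<forall>u\<in>false_twin_verts G. compatible_bases k H closed_nbhd (twin_class G u))"

definition property_P3 ::
  "'a pair_pre_digraph \<Rightarrow> ('a \<Rightarrow> 'b pair_pre_digraph) \<Rightarrow> nat \<Rightarrow> bool" where
  "property_P3 G H k \<longleftrightarrow> (\<forall>u\<in>true_twin_verts G. compatible_bases k H nbhd (twin_class G u))"

definition property_P4 ::
  "'a pair_pre_digraph \<Rightarrow> ('a \<Rightarrow> 'b pair_pre_digraph) \<Rightarrow> nat \<Rightarrow> bool" where
  "property_P4 G H k \<longleftrightarrow> (\<forall>u\<in>false_twin_verts G. compatible_bases k H non_nbhd (twin_class G u))"


section \<open>Well-formedness of the constructions\<close>

lemma pair_graph_gcomplement:
  assumes "pair_graph G"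
  shows "pair_graph (gcomplement G)"
proof -
  interpret pair_graph G by fact
  have "finite {(x, y). x \<in> pverts G \<and> y \<in> pverts G \<and> x \<noteq> y \<and> (x, y) \<notin> parcs G}"
    by (rule finite_subset[of _ "pverts G \<times> pverts G"]) (auto simp: pair_finite_verts)
  then show ?thesis
    by unfold_locales
      (auto simp: gcomplement_def symmetric_def sym_def pair_finite_verts dest: arcs_symmetric)
qed

lemma pair_graph_lex_product:
  assumes "pair_graph G" and "\<And>u. u \<in> pverts G \<Longrightarrow> pair_graph (H u)"
  shows "pair_graph (lex_product G H)"
proof -
  interpret G: pair_graph G by fact
  let ?V = "SIGMA u:pverts G. pverts (H u)"
  have symH: "(w, v) \<in> parcs (H u)" if "u \<in> pverts G" "(v, w) \<in> parcs (H u)" for u v w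
    using assms(2)[OF that(1)] that(2)
    by (meson pair_graph_def pair_pseudo_graph_def pair_sym_digraph.arcs_symmetric)
  have loopH: "(v, v) \<notin> parcs (H u)" if "u \<in> pverts G" for u v
    using assms(2)[OF that]
    by (meson pair_digraph_def pair_graph_def pair_loopfree_digraph.no_loops')
  have fin: "finite ?V"
    using assms(2) by (auto simp: G.pair_finite_verts pair_graph_def pair_digraph_def
        pair_fin_digraph_def pair_fin_digraph_axioms_def)
  have "finite (parcs (lex_product G H))"
    by (rule finite_subset[of _ "?V \<times> ?V"]) (use fin in \<open>auto simp: lex_product_def\<close>)
  with fin show ?thesis
    by unfold_locales
      (auto simp: lex_product_def symmetric_def sym_def
        dest: G.arcs_symmetric G.no_loops' symH loopH)
qed

lemma equiv_twin_rel:
  assumes "pair_graph G"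
  shows "equiv (pverts G) (twin_rel G)"
proof -
  interpret pair_graph G by fact
  have "trans (twin_rel G)"
  proof (rule transI)
    fix x y z assume "(x, y) \<in> twin_rel G" "(y, z) \<in> twin_rel G"
    then show "(x, z) \<in> twin_rel G"
      unfolding twin_rel_def nbhd_def set_eq_iff
      by simp (metis arcs_symmetric no_loops')
  qed
  then show ?thesis
    by (auto simp: equiv_def refl_on_def sym_def twin_rel_def)
qed

lemma vertex_kinds_cover:
  assumes "pair_graph G"
  shows "pverts G = singleton_verts G \<union> false_twin_verts G \<union> true_twin_verts G"
proof -
  interpret pair_graph G by fact
  have eq: "equiv (pverts G) (twin_rel G)"
    using assms by (rule equiv_twin_rel)
  have un: "\<Union>(pverts G // twin_rel G) = pverts G"
    using eq by (rule Union_quotient)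
  have kind: "pairwise (false_twins G) C \<or> pairwise (true_twins G) C"
    if C: "C \<in> pverts G // twin_rel G" for C
  proof -
    have rel: "(x, y) \<in> twin_rel G" if "x \<in> C" "y \<in> C" for x y
      using eq C that by (meson quotient_eq_iff)
    have adj: "(x, y) \<in> parcs G" if "x \<in> C" "y \<in> C" "\<not> false_twins G x y" "x \<noteq> y" for x y
      using rel[OF that(1,2)] that(3,4) arcs_symmetric no_loops'
      unfolding twin_rel_def false_twins_def nbhd_def by auto
    have nadj: "(x, y) \<notin> parcs G" if "x \<in> C" "y \<in> C" "\<not> true_twins G x y" "x \<noteq> y" for x y
      using rel[OF that(1,2)] that(3,4) arcs_symmetric no_loops'
      unfolding twin_rel_def true_twins_def closed_nbhd_def nbhd_def by auto
    have step: "(a, z) \<in> parcs G"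
      if "a \<in> C" "b \<in> C" "z \<in> C" "(b, z) \<in> parcs G" "a \<noteq> z" for a b z
      using rel[OF that(1,2)] that(4,5) unfolding twin_rel_def nbhd_def by auto
    show ?thesis
    proof (rule ccontr)
      assume "\<not> ?thesis"
      then obtain x y a b where xy: "x \<in> C" "y \<in> C" "x \<noteq> y" "\<not> false_twins G x y"
        and ab: "a \<in> C" "b \<in> C" "a \<noteq> b" "\<not> true_twins G a b"
        unfolding pairwise_def by blast
      show False
        using adj[OF xy(1,2,4,3)] nadj[OF ab(1,2,4,3)] step xy(1,2,3) ab(1,2,3)
          arcs_symmetric by metis
    qed
  qed
  show ?thesis
    unfolding singleton_verts_def false_twin_verts_def true_twin_verts_def
    by (subst un[symmetric]) (use kind in blast)
qed

end

theory Submission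
  imports Defs
begin

text \<open>
  Two vertices of the same copy \<open>H u\<close> are equidistant from every vertex outside that copy, and
  inside it distances are \<open>0\<close>, \<open>1\<close> or \<open>2\<close>, since \<open>u\<close> has a neighbour. Hence the
  slices of a metric generator of \<open>G \<circ> H\<close> are adjacency generators, which gives the lower bound.
  Conversely, a union of adjacency bases distinguishes vertices of the same copy; vertices of copies
  over non-twins are distinguished by a whole third basis, and for twins one needs exactly the
  conditions P1 and P2. Part (ii) is part (i) for the complements: complementation
  preserves adjacency generators and exchanges closed neighbourhoods with non-neighbourhoods.
\<close>

section \<open>Distances\<close>

text \<open>Walks appear in the library distance as lists of arcs. Powers of the arc relation keep
  only their length, which is what the later inductions need. Peeling off the first arc matches the
  two; for length \<open>0\<close> the empty walk must start at a vertex, hence the assumption on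
  \<open>x\<close>.\<close>

lemma relpow_iff_awalk:
  assumes "pair_wf_digraph X" and "x \<in> pverts X"
  shows "(x, y) \<in> parcs X ^^ n \<longleftrightarrow> (\<exists>p. pre_digraph.awalk (with_proj X) x p y \<and> length p = n)"
  using assms(2)
proof (induction n arbitrary: x)
  case 0
  interpret pair_wf_digraph X by fact
  show ?case using 0 by (auto simp: awalk_Nil_iff)
next
  case (Suc n)
  interpret pair_wf_digraph X by fact
  show ?case
  proof
    assume "(x, y) \<in> parcs X ^^ Suc n"
    then obtain z where z: "(x, z) \<in> parcs X" "(z, y) \<in> parcs X ^^ n"
      by (meson relpow_Suc_D2)
    then obtain p where "awalk z p y" "length p = n"
      using Suc.IH[of z] in_arcsD2 by blast
    then have "awalk x ((x, z) # p) y" "length ((x, z) # p) = Suc n"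
      using z(1) by (auto simp: awalk_Cons_iff)
    then show "\<exists>p. awalk x p y \<and> length p = Suc n" by blast
  next
    assume "\<exists>p. awalk x p y \<and> length p = Suc n"
    then obtain e p where p: "awalk x (e # p) y" "length p = n"
      by (metis length_Suc_conv)
    then have "(x, snd e) \<in> parcs X" "awalk (snd e) p y"
      by (auto simp: awalk_Cons_iff)
    then show "(x, y) \<in> parcs X ^^ Suc n"
      using Suc.IH[of "snd e"] p(2) in_arcsD2 by (blast intro: relpow_Suc_I2)
  qed
qed

text \<open>With unit weights the cost of a walk is its length.\<close>

lemma gdist_eq_INF:
  assumes "pair_wf_digraph X" and "x \<in> pverts X"
  shows "gdist X x y = (INF n\<in>{n. (x, y) \<in> parcs X ^^ n}. ereal (real n))"
proof -
  interpret pair_wf_digraph X by fact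
  have cost: "awalk_cost (\<lambda>_. 1) p = real (length p)" for p :: "('a \<times> 'a) awalk"
    by (induction p) simp_all
  have "(\<lambda>p. ereal (awalk_cost (\<lambda>_. 1) p)) ` {p. awalk x p y} =
        (\<lambda>n. ereal (real n)) ` {n. (x, y) \<in> parcs X ^^ n}"
    using relpow_iff_awalk[OF assms, of y] by (auto simp: cost image_iff)
  then show ?thesis by (simp add: gdist_def \<mu>_def)
qed

text \<open>Lengths are natural numbers: if none is at most \<open>n\<close>, then
  \<open>Suc n\<close> is a lower bound of the infimum, also when there is no walk and the distance
  is infinite.\<close>

lemma gdist_le_iff:
  assumes "pair_wf_digraph X" and "x \<in> pverts X"
  shows "gdist X x y \<le> ereal (real n) \<longleftrightarrow> (\<exists>m\<le>n. (x, y) \<in> parcs X ^^ m)"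
proof
  assume le: "gdist X x y \<le> ereal (real n)"
  show "\<exists>m\<le>n. (x, y) \<in> parcs X ^^ m"
  proof (rule ccontr)
    assume "\<not> ?thesis"
    then have "ereal (real (Suc n)) \<le> gdist X x y"
      unfolding gdist_eq_INF[OF assms]
      by (intro INF_greatest) (auto simp: not_le Suc_le_eq[symmetric] simp flip: of_nat_Suc)
    then have "ereal (real (Suc n)) \<le> ereal (real n)" using le by (rule order_trans)
    then show False by simp
  qed
next
  assume "\<exists>m\<le>n. (x, y) \<in> parcs X ^^ m"
  then show "gdist X x y \<le> ereal (real n)"
    unfolding gdist_eq_INF[OF assms] by (auto intro!: INF_lower2)
qed

text \<open>Equality of distances will be shown by two uses of this comparison: every walk from
  \<open>y\<close> is replaced by one from \<open>x\<close> that is no longer. No exact distance has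
  to be computed.\<close>

lemma gdist_le_gdist:
  assumes "pair_wf_digraph X" and "x \<in> pverts X" and "y \<in> pverts X"
    and "\<And>n. (y, z) \<in> parcs X ^^ n \<Longrightarrow> \<exists>m\<le>n. (x, z) \<in> parcs X ^^ m"
  shows "gdist X x z \<le> gdist X y z"
  unfolding gdist_eq_INF[OF assms(1,2)] gdist_eq_INF[OF assms(1,3)]
  using assms(4) by (intro INF_mono) auto

lemma gdist_le_0_iff:
  assumes "pair_wf_digraph X" and "x \<in> pverts X"
  shows "gdist X x y \<le> 0 \<longleftrightarrow> x = y"
  using gdist_le_iff[OF assms, of y 0] by (simp add: zero_ereal_def)

lemma gdist_le_1_iff:
  assumes "pair_wf_digraph X" and "x \<in> pverts X"
  shows "gdist X x y \<le> 1 \<longleftrightarrow> x = y \<or> (x, y) \<in> parcs X"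
  using gdist_le_iff[OF assms, of y 1] by (auto simp: one_ereal_def le_Suc_eq)

text \<open>One distance stays within the threshold \<open>0\<close> or \<open>1\<close> and the
  other exceeds it. These two thresholds yield all separations needed for the upper bound.\<close>

lemma gdist_neqI:
  assumes "pair_wf_digraph X" and "x \<in> pverts X" and "y \<in> pverts X"
    and "x = z \<and> y \<noteq> z \<or> (x, z) \<in> parcs X \<and> y \<noteq> z \<and> (y, z) \<notin> parcs X"
  shows "gdist X x z \<noteq> gdist X y z"
  using assms(4) gdist_le_0_iff[OF assms(1,2), of z] gdist_le_0_iff[OF assms(1,3), of z]
    gdist_le_1_iff[OF assms(1,2), of z] gdist_le_1_iff[OF assms(1,3), of z]
  by metis

lemma two_distinct_elements:
  assumes "card A \<ge> 2"
  shows "\<exists>x\<in>A. \<exists>y\<in>A. x \<noteq> y"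
proof -
  have "finite A" using assms card.infinite by fastforce
  then show ?thesis using assms card_le_Suc0_iff_eq[of A] by force
qed

lemma connected_imp_nbhd_nonempty:
  assumes "pair_graph G" and "Digraph_Component.connected (with_proj G)"
    and "card (pverts G) \<ge> 2" and "u \<in> pverts G"
  shows "nbhd G u \<noteq> {}"
proof -
  interpret pair_graph G by fact
  obtain v where v: "v \<in> pverts G" "v \<noteq> u"
    using two_distinct_elements[OF assms(3)] by metis
  \<comment> \<open>Connectedness is defined through the symmetric closure of the digraph; since the
    arcs are symmetric already, reachability is the same, and the first arc of a walk to
    \<open>v\<close> gives the neighbour.\<close>
  have "u \<rightarrow>\<^sup>*\<^bsub>with_proj (mk_symmetric (with_proj G))\<^esub> v"
    using assms(2,4) v(1) unfolding connected_def by (auto simp: strongly_connected_def)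
  then have "u \<rightarrow>\<^sup>*\<^bsub>with_proj G\<^esub> v"
    using reachable_mk_symmetric_eq pair_sym_arcs by blast
  then obtain w where "(u, w) \<in> parcs G"
    using v(2) by (auto elim: converse_reachable_cases)
  then show ?thesis by (auto simp: nbhd_def)
qed

section \<open>Adjacency generators and complements\<close>

lemma adj_dim_le:
  assumes "adj_generator k H S"
  shows "adj_dim k H \<le> card S"
  unfolding adj_dim_def using assms by (auto intro: cInf_lower)

lemma adj_basis_exists:
  assumes "adj_generator k H S"
  obtains A where "adj_basis k H A"
proof -
  have "Inf (card ` {S. adj_generator k H S}) \<in> card ` {S. adj_generator k H S}"
    using assms by (intro Inf_nat_def1) auto
  then show ?thesis using that by (auto simp: adj_basis_def adj_dim_def)
qed

text \<open>The bound on \<open>k\<close> by \<open>adj_bound\<close> makes generators exist, so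
  that \<open>adj_dim\<close> is a genuine minimum rather than the default \<open>0\<close>.\<close>

lemma adj_generator_pverts:
  assumes "pair_graph H" and "k \<le> adj_bound H"
  shows "adj_generator k H (pverts H)"
  unfolding adj_generator_def
proof (intro conjI ballI impI)
  interpret pair_graph H by fact
  fix x y assume xy: "x \<in> pverts H" "y \<in> pverts H" "x \<noteq> y"
  let ?D = "{card (adj_distinguishers H x y) | x y. x \<in> pverts H \<and> y \<in> pverts H \<and> x \<noteq> y}"
  have "finite ?D"
    by (rule finite_subset[of _ "(\<lambda>(x, y). card (adj_distinguishers H x y)) ` (pverts H \<times> pverts H)"])
      (auto simp: pair_finite_verts)
  then have "adj_bound H \<le> card (adj_distinguishers H x y)"
    unfolding adj_bound_def using xy by (intro Min_le) blast+
  moreover have "adj_distinguishers H x y \<subseteq> pverts H"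
    using xy in_arcsD2 by (auto simp: adj_distinguishers_def nbhd_def)
  ultimately show "k \<le> card (adj_distinguishers H x y \<inter> pverts H)"
    using assms(2) by (simp add: Int_absorb2)
qed simp

lemma card_le_adj_generator:
  assumes "adj_generator k H A" and "finite (pverts H)" and "card (pverts H) \<ge> 2"
  shows "k \<le> card A"
proof -
  obtain x y where "x \<in> pverts H" "y \<in> pverts H" "x \<noteq> y"
    using two_distinct_elements[OF assms(3)] by blast
  then have "k \<le> card (adj_distinguishers H x y \<inter> A)"
    using assms(1) by (auto simp: adj_generator_def)
  also have "\<dots> \<le> card A"
    using assms(1,2) by (intro card_mono) (auto simp: adj_generator_def dest: finite_subset)
  finally show ?thesis .
qed

section \<open>Invariance of adjacency generators under complementation\<close>

lemma pverts_gcomplement [simp]: "pverts (gcomplement H) = pverts H"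
  by (simp add: gcomplement_def)

text \<open>Complementation flips the adjacency of a third vertex to both \<open>x\<close> and
  \<open>y\<close>, so it preserves the symmetric difference outside \<open>{x, y}\<close>; adding
  \<open>{x, y}\<close> hides the changes at these two.\<close>

lemma adj_distinguishers_gcomplement:
  assumes "pair_graph H" and "x \<in> pverts H" and "y \<in> pverts H"
  shows "adj_distinguishers (gcomplement H) x y = adj_distinguishers H x y"
proof -
  interpret pair_graph H by fact
  show ?thesis
    using assms(2,3) no_loops' in_arcsD2
    by (auto simp: adj_distinguishers_def nbhd_def gcomplement_def)
qed

lemma adj_generator_gcomplement:
  assumes "pair_graph H"
  shows "adj_generator k (gcomplement H) = adj_generator k H"
  using adj_distinguishers_gcomplement[OF assms] by (auto simp: fun_eq_iff adj_generator_def)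

lemma adj_dim_gcomplement:
  assumes "pair_graph H"
  shows "adj_dim k (gcomplement H) = adj_dim k H"
  by (simp add: adj_dim_def adj_generator_gcomplement[OF assms])

lemma adj_basis_gcomplement:
  assumes "pair_graph H"
  shows "adj_basis k (gcomplement H) = adj_basis k H"
  by (simp add: fun_eq_iff adj_basis_def adj_generator_gcomplement[OF assms]
      adj_dim_gcomplement[OF assms])

text \<open>The right-hand side is the closed neighbourhood of \<open>x\<close> in \<open>H\<close>.
  An inclusion suffices, because compatibility only asks for lower bounds on cardinalities.\<close>

lemma nbhd_subset_non_nbhd_gcomplement:
  assumes "pair_graph H" and "x \<in> pverts H"
  shows "nbhd H x \<subseteq> non_nbhd (gcomplement H) x"
proof -
  interpret pair_graph H by fact
  show ?thesis using in_arcsD2 by (auto simp: nbhd_def non_nbhd_def gcomplement_def)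
qed

lemma non_nbhd_subset_closed_nbhd_gcomplement:
  assumes "x \<in> pverts H"
  shows "non_nbhd H x \<subseteq> closed_nbhd (gcomplement H) x"
  using assms by (auto simp: nbhd_def non_nbhd_def closed_nbhd_def gcomplement_def)

text \<open>The same bases \<open>A\<close> serve for the complements, and enlarging
  \<open>N\<close> to \<open>M\<close> can only increase the counted finite sets.\<close>

lemma compatible_bases_gcomplement:
  assumes "compatible_bases k H N C"
    and "\<And>u. u \<in> C \<Longrightarrow> pair_graph (H u)"
    and "\<And>u x. u \<in> C \<Longrightarrow> x \<in> pverts (H u) \<Longrightarrow> N (H u) x \<subseteq> M (gcomplement (H u)) x"
  shows "compatible_bases k (\<lambda>u. gcomplement (H u)) M C"
proof -
  obtain A where A: "\<And>i. i \<in> C \<Longrightarrow> adj_basis k (H i) (A i)"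
    and k: "\<And>j l x y. j \<in> C \<Longrightarrow> l \<in> C \<Longrightarrow> j \<noteq> l \<Longrightarrow> x \<in> pverts (H j) \<Longrightarrow> y \<in> pverts (H l) \<Longrightarrow>
        k \<le> card (({j} \<times> (A j \<inter> N (H j) x)) \<union> ({l} \<times> (A l \<inter> N (H l) y)))"
    using assms(1) unfolding compatible_bases_def by blast
  have fin: "finite (A i)" if "i \<in> C" for i
  proof -
    interpret pair_graph "H i" using assms(2) that .
    show ?thesis
      using A[OF that] pair_finite_verts
      by (auto simp: adj_basis_def adj_generator_def dest: finite_subset)
  qed
  show ?thesis
    unfolding compatible_bases_def
  proof (intro exI[of _ A] conjI ballI impI)
    fix i assume "i \<in> C"
    then show "adj_basis k (gcomplement (H i)) (A i)"
      using A assms(2) by (simp add: adj_basis_gcomplement)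
  next
    fix j l x y
    assume *: "j \<in> C" "l \<in> C" "j \<noteq> l" "x \<in> pverts (gcomplement (H j))"
      "y \<in> pverts (gcomplement (H l))"
    then have "k \<le> card (({j} \<times> (A j \<inter> N (H j) x)) \<union> ({l} \<times> (A l \<inter> N (H l) y)))"
      by (intro k) simp_all
    also have "\<dots> \<le> card (({j} \<times> (A j \<inter> M (gcomplement (H j)) x)) \<union>
        ({l} \<times> (A l \<inter> M (gcomplement (H l)) y)))"
      using * fin assms(3)[of j x] assms(3)[of l y] by (intro card_mono) auto
    finally show "k \<le> \<dots>" .
  qed
qed

section \<open>Twin classes\<close>

lemma twin_class_eq:
  assumes "pair_graph G" and "(u, v) \<in> twin_rel G"
  shows "twin_class G u = twin_class G v"
  using assms equiv_class_eq equiv_twin_rel by metis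

lemma quotient_containing_iff:
  assumes "pair_graph G" and "u \<in> pverts G"
  shows "C \<in> pverts G // twin_rel G \<and> u \<in> C \<longleftrightarrow> C = twin_class G u"
proof
  assume C: "C \<in> pverts G // twin_rel G \<and> u \<in> C"
  then obtain v where "C = twin_class G v" "(v, u) \<in> twin_rel G"
    by (auto elim!: quotientE)
  then show "C = twin_class G u" using twin_class_eq[OF assms(1)] by blast
next
  assume "C = twin_class G u"
  then show "C \<in> pverts G // twin_rel G \<and> u \<in> C"
    using quotientI[OF assms(2), of "twin_rel G"] assms(2) by (auto simp: twin_rel_def)
qed

text \<open>Only one class contains \<open>u\<close>, so membership in a union of selected classes
  is a property of that class. This unfolds all three kinds of vertices.\<close>

lemma in_Union_quotient_iff:
  assumes "pair_graph G" and "u \<in> pverts G"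
  shows "u \<in> \<Union>{C \<in> pverts G // twin_rel G. P C} \<longleftrightarrow> P (twin_class G u)"
proof -
  have "u \<in> \<Union>{C \<in> pverts G // twin_rel G. P C} \<longleftrightarrow>
      (\<exists>C. (C \<in> pverts G // twin_rel G \<and> u \<in> C) \<and> P C)" by blast
  also have "\<dots> \<longleftrightarrow> P (twin_class G u)"
    by (simp only: quotient_containing_iff[OF assms] simp_thms)
  finally show ?thesis .
qed

lemma false_twin_verts_iff:
  assumes "pair_graph G" and "u \<in> pverts G"
  shows "u \<in> false_twin_verts G \<longleftrightarrow>
    \<not> is_singleton (twin_class G u) \<and> pairwise (false_twins G) (twin_class G u)"
  unfolding false_twin_verts_def by (rule in_Union_quotient_iff[OF assms])

lemma true_twin_verts_iff:
  assumes "pair_graph G" and "u \<in> pverts G"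
  shows "u \<in> true_twin_verts G \<longleftrightarrow>
    \<not> is_singleton (twin_class G u) \<and> pairwise (true_twins G) (twin_class G u)"
  unfolding true_twin_verts_def by (rule in_Union_quotient_iff[OF assms])

text \<open>The common class contains both \<open>u\<close> and \<open>v\<close>, so it is no
  singleton, and the cover by the three kinds leaves only false and true twins.\<close>

lemma twin_verts_cases:
  assumes "pair_graph G" and "(u, v) \<in> twin_rel G" and "u \<noteq> v"
  obtains (false) "u \<in> false_twin_verts G" "false_twins G u v"
        | (true) "u \<in> true_twin_verts G" "true_twins G u v"
proof -
  have u: "u \<in> pverts G" and uv: "u \<in> twin_class G u" "v \<in> twin_class G u"
    using assms(2) by (auto simp: twin_rel_def)
  have "\<not> is_singleton (twin_class G u)"
    using uv assms(3) by (metis is_singletonE singletonD)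
  then have "u \<notin> singleton_verts G"
    unfolding singleton_verts_def by (simp only: in_Union_quotient_iff[OF assms(1) u] not_False_eq_True)
  then have "u \<in> false_twin_verts G \<or> u \<in> true_twin_verts G"
    using vertex_kinds_cover[OF assms(1)] u by blast
  then show ?thesis
  proof
    assume "u \<in> false_twin_verts G"
    moreover from this have "pairwise (false_twins G) (twin_class G u)"
      using false_twin_verts_iff[OF assms(1) u] by blast
    then have "false_twins G u v" using uv assms(3) by (rule pairwiseD)
    ultimately show ?thesis by (rule that(1))
  next
    assume "u \<in> true_twin_verts G"
    moreover from this have "pairwise (true_twins G) (twin_class G u)"
      using true_twin_verts_iff[OF assms(1) u] by blast
    then have "true_twins G u v" using uv assms(3) by (rule pairwiseD)
    ultimately show ?thesis by (rule that(2))
  qed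
qed

section \<open>Metric generators of lexicographic products\<close>

text \<open>Connectedness of \<open>G\<close> enters as the existence of neighbours, which allows
  detours of length two. The locale is interpreted for the given family and again for its
  complements.\<close>

locale lex_family =
  fixes G :: "'a pair_pre_digraph" and H :: "'a \<Rightarrow> 'b pair_pre_digraph"
  assumes pair_graph_G: "pair_graph G"
    and nbhd_nonempty: "u \<in> pverts G \<Longrightarrow> nbhd G u \<noteq> {}"
    and pair_graph_H: "u \<in> pverts G \<Longrightarrow> pair_graph (H u)"
    and card_H: "u \<in> pverts G \<Longrightarrow> card (pverts (H u)) \<ge> 2"
begin

sublocale G: pair_graph G
  by (rule pair_graph_G)

abbreviation "X \<equiv> lex_product G H"

sublocale X: pair_graph X
  using pair_graph_G pair_graph_H by (rule pair_graph_lex_product)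

lemma in_pverts_X [simp]: "(u, v) \<in> pverts X \<longleftrightarrow> u \<in> pverts G \<and> v \<in> pverts (H u)"
  by (auto simp: lex_product_def)

lemma in_parcs_X:
  "((u, v), (u', w)) \<in> parcs X \<longleftrightarrow>
     u \<in> pverts G \<and> v \<in> pverts (H u) \<and> u' \<in> pverts G \<and> w \<in> pverts (H u') \<and>
     ((u, u') \<in> parcs G \<or> u = u' \<and> (v, w) \<in> parcs (H u))"
  by (auto simp: lex_product_def)

lemma finite_H: "u \<in> pverts G \<Longrightarrow> finite (pverts (H u))"
  using card_H by (metis card.infinite not_numeral_le_zero)

text \<open>Arcs of the walk that stay in the copy of \<open>u\<close> are dropped. The first arc
  leaving it comes from an arc of \<open>G\<close>, so it can equally start at
  \<open>(u, x)\<close>.\<close>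

lemma relpow_outside_copy:
  assumes "((u, y), (u', w)) \<in> parcs X ^^ n" and "x \<in> pverts (H u)" and "u' \<noteq> u"
  shows "\<exists>m\<le>n. ((u, x), (u', w)) \<in> parcs X ^^ m"
  using assms(1)
proof (induction n arbitrary: y)
  case 0
  then show ?case using assms(3) by simp
next
  case (Suc n)
  then obtain s t where st: "((u, y), (s, t)) \<in> parcs X" "((s, t), (u', w)) \<in> parcs X ^^ n"
    by (metis relpow_Suc_D2 surj_pair)
  show ?case
  proof (cases "s = u")
    case True
    then show ?thesis using Suc.IH st(2) le_SucI by blast
  next
    case False
    then have "((u, x), (s, t)) \<in> parcs X"
      using st(1) assms(2) by (auto simp: in_parcs_X)
    then show ?thesis using st(2) by (meson relpow_Suc_I2 order_refl)
  qed
qed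

lemma gdist_outside_copy:
  assumes "u \<in> pverts G" "x \<in> pverts (H u)" "y \<in> pverts (H u)" "u' \<noteq> u"
  shows "gdist X (u, x) (u', w) = gdist X (u, y) (u', w)"
proof -
  have "gdist X (u, x) (u', w) \<le> gdist X (u, y) (u', w)"
    if "x \<in> pverts (H u)" "y \<in> pverts (H u)" for x y
  proof (rule gdist_le_gdist[OF X.pair_wf_digraph_axioms])
    show "\<exists>m\<le>n. ((u, x), (u', w)) \<in> parcs X ^^ m"
      if "((u, y), (u', w)) \<in> parcs X ^^ n" for n
      using that \<open>x \<in> pverts (H u)\<close> assms(4) by (rule relpow_outside_copy)
  qed (use assms(1) that in simp_all)
  then show ?thesis using assms(2,3) by (simp add: order_eq_iff)
qed

text \<open>Length \<open>0\<close> is excluded by \<open>v \<noteq> y\<close>, and an arc is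
  transferred by the adjacency assumption. Any longer walk is at least as long as the detour of
  length two through the copy of a neighbour \<open>s\<close> of \<open>u\<close>.\<close>

lemma relpow_inside_copy:
  assumes "((u, y), (u, v)) \<in> parcs X ^^ n" and "u \<in> pverts G" and "v \<in> pverts (H u)"
    and "x \<in> pverts (H u)" and "v \<noteq> y" and "(y, v) \<in> parcs (H u) \<longleftrightarrow> (x, v) \<in> parcs (H u)"
  shows "\<exists>m\<le>n. ((u, x), (u, v)) \<in> parcs X ^^ m"
proof (cases "n \<le> 1")
  case True
  with assms(1,5) have "n = 1" by (auto simp: le_Suc_eq)
  then have "((u, x), (u, v)) \<in> parcs X ^^ 1"
    using assms by (auto simp: in_parcs_X)
  with \<open>n = 1\<close> show ?thesis by blast
next
  case False
  obtain s where s: "(u, s) \<in> parcs G"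
    using nbhd_nonempty[OF assms(2)] by (auto simp: nbhd_def)
  then have "s \<in> pverts G" by (rule G.in_arcsD2)
  then obtain t where "t \<in> pverts (H s)"
    using card_H[of s] by fastforce
  then have "((u, x), (s, t)) \<in> parcs X" "((s, t), (u, v)) \<in> parcs X"
    using s assms(2-4) \<open>s \<in> pverts G\<close> G.arcs_symmetric by (auto simp: in_parcs_X)
  then have "((u, x), (u, v)) \<in> parcs X ^^ 2"
    by (auto simp: numeral_2_eq_2)
  then show ?thesis using False by (intro exI[of _ 2]) auto
qed

lemma gdist_inside_copy:
  assumes "u \<in> pverts G" "x \<in> pverts (H u)" "y \<in> pverts (H u)" "v \<in> pverts (H u)"
    and "v \<notin> adj_distinguishers (H u) x y"
  shows "gdist X (u, x) (u, v) = gdist X (u, y) (u, v)"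
proof -
  have "gdist X (u, x) (u, v) \<le> gdist X (u, y) (u, v)"
    if "x \<in> pverts (H u)" "y \<in> pverts (H u)" "v \<noteq> y"
      "(y, v) \<in> parcs (H u) \<longleftrightarrow> (x, v) \<in> parcs (H u)" for x y
  proof (rule gdist_le_gdist[OF X.pair_wf_digraph_axioms])
    show "\<exists>m\<le>n. ((u, x), (u, v)) \<in> parcs X ^^ m"
      if "((u, y), (u, v)) \<in> parcs X ^^ n" for n
      using that assms(1,4) \<open>x \<in> pverts (H u)\<close> \<open>v \<noteq> y\<close>
        \<open>(y, v) \<in> parcs (H u) \<longleftrightarrow> (x, v) \<in> parcs (H u)\<close> by (rule relpow_inside_copy)
  qed (use assms(1) that in simp_all)
  moreover have "v \<noteq> x" "v \<noteq> y" "(y, v) \<in> parcs (H u) \<longleftrightarrow> (x, v) \<in> parcs (H u)"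
    using assms(5) by (auto simp: adj_distinguishers_def nbhd_def)
  ultimately show ?thesis using assms(2,3) by (simp add: order_eq_iff)
qed

section \<open>Lower bound: slices of metric generators\<close>

lemma adj_generator_slice:
  assumes S: "metric_generator k X S" and u: "u \<in> pverts G"
  shows "adj_generator k (H u) {v. (u, v) \<in> S}"
  unfolding adj_generator_def
proof (intro conjI ballI impI)
  have SX: "S \<subseteq> pverts X" using S by (simp add: metric_generator_def)
  then show "{v. (u, v) \<in> S} \<subseteq> pverts (H u)" by auto
  fix x y assume xy: "x \<in> pverts (H u)" "y \<in> pverts (H u)" "x \<noteq> y"
  let ?D = "adj_distinguishers (H u) x y \<inter> {v. (u, v) \<in> S}"
  have "k \<le> card {w \<in> S. gdist X (u, x) w \<noteq> gdist X (u, y) w}"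
    using S xy u by (auto simp: metric_generator_def)
  \<comment> \<open>A vertex of \<open>S\<close> separating the pair must lie in the copy of
    \<open>u\<close>, and there it must be an adjacency distinguisher.\<close>
  also have "\<dots> \<le> card (Pair u ` ?D)"
  proof (rule card_mono)
    show "finite (Pair u ` ?D)"
      using SX finite_H[OF u] by (auto intro!: finite_imageI elim!: rev_finite_subset)
    show "{w \<in> S. gdist X (u, x) w \<noteq> gdist X (u, y) w} \<subseteq> Pair u ` ?D"
    proof clarify
      fix u' v assume w: "(u', v) \<in> S" "gdist X (u, x) (u', v) \<noteq> gdist X (u, y) (u', v)"
      then have [simp]: "u' = u" using gdist_outside_copy[OF u xy(1,2)] by blast
      have "v \<in> adj_distinguishers (H u) x y"
        using gdist_inside_copy[OF u xy(1,2), of v] w SX by fastforce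
      then show "(u', v) \<in> Pair u ` ?D" using w(1) by auto
    qed
  qed
  also have "\<dots> = card ?D" by (simp add: card_image inj_on_def)
  finally show "k \<le> card ?D" .
qed

text \<open>\<open>S\<close> is the disjoint union of its slices, each of which has at least
  \<open>adj_dim\<close> elements.\<close>

lemma sum_adj_dim_le:
  assumes S: "metric_generator k X S"
  shows "(\<Sum>u\<in>pverts G. adj_dim k (H u)) \<le> card S"
proof -
  have SX: "S \<subseteq> pverts X" using S by (simp add: metric_generator_def)
  then have "S = (SIGMA u:pverts G. {v. (u, v) \<in> S})" by auto
  then have "card S = card (SIGMA u:pverts G. {v. (u, v) \<in> S})" by (rule arg_cong)
  moreover have "finite {v. (u, v) \<in> S}" if "u \<in> pverts G" for u
    using SX finite_H[OF that] by (auto elim!: rev_finite_subset)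
  ultimately have "card S = (\<Sum>u\<in>pverts G. card {v. (u, v) \<in> S})"
    by (simp add: card_SigmaI G.pair_finite_verts)
  then show ?thesis
    using adj_dim_le[OF adj_generator_slice[OF S]] by (simp add: sum_mono)
qed

section \<open>Upper bound: unions of compatible adjacency bases\<close>

lemma metric_generator_Sigma:
  assumes A: "\<And>u. u \<in> pverts G \<Longrightarrow> adj_generator k (H u) (A u)"
    and true: "\<And>u u' x y. true_twins G u u' \<Longrightarrow> (u, u') \<in> twin_rel G \<Longrightarrow>
      x \<in> pverts (H u) \<Longrightarrow> y \<in> pverts (H u') \<Longrightarrow>
      k \<le> card (({u} \<times> (A u \<inter> non_nbhd (H u) x)) \<union> ({u'} \<times> (A u' \<inter> non_nbhd (H u') y)))"
    and false: "\<And>u u' x y. false_twins G u u' \<Longrightarrow> (u, u') \<in> twin_rel G \<Longrightarrow>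
      x \<in> pverts (H u) \<Longrightarrow> y \<in> pverts (H u') \<Longrightarrow>
      k \<le> card (({u} \<times> (A u \<inter> closed_nbhd (H u) x)) \<union> ({u'} \<times> (A u' \<inter> closed_nbhd (H u') y)))"
  shows "metric_generator k X (SIGMA u:pverts G. A u)"
proof -
  let ?S = "SIGMA u:pverts G. A u"
  have AH: "A u \<subseteq> pverts (H u)" if "u \<in> pverts G" for u
    using A[OF that] by (simp add: adj_generator_def)
  then have SX: "?S \<subseteq> pverts X" by fastforce
  then have finS: "finite ?S" using X.pair_finite_verts finite_subset by blast
  have irrefl: "(v, v) \<notin> parcs G" for v using G.no_loops' by blast
  have distinguished: "k \<le> card {w \<in> ?S. gdist X (u, x) w \<noteq> gdist X (u', y) w}"
    if u: "u \<in> pverts G" "x \<in> pverts (H u)" and u': "u' \<in> pverts G" "y \<in> pverts (H u')"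
      and ne: "(u, x) \<noteq> (u', y)" for u x u' y
  proof -
    let ?D = "{w \<in> ?S. gdist X (u, x) w \<noteq> gdist X (u', y) w}"
    have dist: "w \<in> ?D" if "w \<in> ?S"
      "(u, x) = w \<and> (u', y) \<noteq> w \<or> (u', y) = w \<and> (u, x) \<noteq> w \<or>
       ((u, x), w) \<in> parcs X \<and> (u', y) \<noteq> w \<and> ((u', y), w) \<notin> parcs X \<or>
       ((u', y), w) \<in> parcs X \<and> (u, x) \<noteq> w \<and> ((u, x), w) \<notin> parcs X" for w
    proof -
      have "(u, x) \<in> pverts X" "(u', y) \<in> pverts X" using u u' by simp_all
      then have "gdist X (u, x) w \<noteq> gdist X (u', y) w"
        using that(2) gdist_neqI[OF X.pair_wf_digraph_axioms, of "(u, x)" "(u', y)" w]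
          gdist_neqI[OF X.pair_wf_digraph_axioms, of "(u', y)" "(u, x)" w] by metis
      then show ?thesis using that(1) by blast
    qed
    have le: "k \<le> card ?D" if "k \<le> card T" "T \<subseteq> ?D" for T
    proof -
      have "finite ?D" using finS by (rule rev_finite_subset) auto
      then show ?thesis using that card_mono order_trans by blast
    qed
    consider (copy) "u = u'" | (twins) "u \<noteq> u'" "(u, u') \<in> twin_rel G"
      | (other) "u \<noteq> u'" "(u, u') \<notin> twin_rel G" by blast
    then show ?thesis
    proof cases
      case copy
      have "k \<le> card (adj_distinguishers (H u) x y \<inter> A u)"
        using A[OF u(1)] u u' ne copy by (auto simp: adj_generator_def)
      also have "\<dots> = card (Pair u ` (adj_distinguishers (H u) x y \<inter> A u))"
        by (simp add: card_image inj_on_def)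
      finally show ?thesis
      proof (rule le)
        show "Pair u ` (adj_distinguishers (H u) x y \<inter> A u) \<subseteq> ?D"
        proof (rule image_subsetI)
          fix v assume v: "v \<in> adj_distinguishers (H u) x y \<inter> A u"
          then have "v \<in> pverts (H u)" using AH[OF u(1)] by blast
          with v show "(u, v) \<in> ?D"
            using u u' ne copy irrefl
            by (intro dist) (auto simp: adj_distinguishers_def nbhd_def in_parcs_X)
        qed
      qed
    next
      case twins
      have sym: "(u, u') \<in> parcs G \<longleftrightarrow> (u', u) \<in> parcs G" using G.arcs_symmetric by blast
      from pair_graph_G twins(2,1) show ?thesis
      proof (cases rule: twin_verts_cases)
        case false
        then have nadj: "(u, u') \<notin> parcs G" "(u', u) \<notin> parcs G"
          using G.no_loops' by (auto simp: false_twins_def nbhd_def)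
        \<comment> \<open>Copies over false twins are not joined: a vertex of one copy is at
          distance at least two from every vertex of the other, so it separates as soon as it lies
          in the closed neighbourhood within its own copy.\<close>
        show ?thesis
        proof (rule le[OF assms(3)[OF false(2) twins(2) u(2) u'(2)]], intro subsetI)
          fix w assume "w \<in> ({u} \<times> (A u \<inter> closed_nbhd (H u) x)) \<union>
            ({u'} \<times> (A u' \<inter> closed_nbhd (H u') y))"
          then show "w \<in> ?D"
            using u u' AH[OF u(1)] AH[OF u'(1)] nadj twins(1)
            by (intro dist) (auto simp: closed_nbhd_def nbhd_def in_parcs_X)
        qed
      next
        case true
        then have adj: "(u, u') \<in> parcs G" "(u', u) \<in> parcs G"
          using sym by (auto simp: true_twins_def closed_nbhd_def nbhd_def)
        \<comment> \<open>Copies over true twins are completely joined: a vertex of one copy is at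
          distance one from every vertex of the other, so it separates if it is not a neighbour
          within its own copy. The vertex itself also counts, at distance \<open>0\<close>.\<close>
        show ?thesis
        proof (rule le[OF assms(2)[OF true(2) twins(2) u(2) u'(2)]], intro subsetI)
          fix w assume "w \<in> ({u} \<times> (A u \<inter> non_nbhd (H u) x)) \<union>
            ({u'} \<times> (A u' \<inter> non_nbhd (H u') y))"
          then show "w \<in> ?D"
            using u u' AH[OF u(1)] AH[OF u'(1)] adj twins(1) irrefl
            by (intro dist) (auto simp: non_nbhd_def nbhd_def in_parcs_X)
        qed
      qed
    next
      case other
      then have "nbhd G u - {u'} \<noteq> nbhd G u' - {u}"
        using u u' by (simp add: twin_rel_def)
      \<comment> \<open>This \<open>z\<close> differs from \<open>u\<close> and \<open>u'\<close>
        and is adjacent to exactly one of them, so every vertex of its copy separates the pair, in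
        particular all of \<open>A z\<close>.\<close>
      then obtain z where "z \<in> nbhd G u - {u'} \<longleftrightarrow> z \<notin> nbhd G u' - {u}" by blast
      then have z: "z \<noteq> u" "z \<noteq> u'" "((u, z) \<in> parcs G) \<noteq> ((u', z) \<in> parcs G)"
        using irrefl by (auto simp: nbhd_def)
      then have zV: "z \<in> pverts G" using G.in_arcsD2 by blast
      have "k \<le> card (A z)"
        using A[OF zV] finite_H[OF zV] card_H[OF zV] by (rule card_le_adj_generator)
      also have "\<dots> = card (Pair z ` A z)" by (simp add: card_image inj_on_def)
      finally show ?thesis
      proof (rule le)
        show "Pair z ` A z \<subseteq> ?D"
          using z zV u u' AH[OF zV] by (intro image_subsetI dist) (auto simp: in_parcs_X)
      qed
    qed
  qed
  show ?thesis
    unfolding metric_generator_def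
  proof (intro conjI SX ballI impI)
    fix p q assume pq: "p \<in> pverts X" "q \<in> pverts X" "p \<noteq> q"
    obtain u x u' y where [simp]: "p = (u, x)" "q = (u', y)" by (metis surj_pair)
    show "k \<le> card {w \<in> ?S. gdist X p w \<noteq> gdist X q w}"
      using distinguished[of u x u' y] pq by simp
  qed
qed

text \<open>The properties supply bases for each twin class separately, so one family over all of
  \<open>G\<close> must be assembled that is compatible within every class. Assuming
  \<open>gen\<close> instead of a bound on \<open>k\<close> lets the result apply directly to
  complements.\<close>

theorem metric_dim_lex_product:
  assumes gen: "\<And>u. u \<in> pverts G \<Longrightarrow> adj_generator k (H u) (pverts (H u))"
    and P1: "property_P1 G H k" and P2: "property_P2 G H k"
  shows "metric_dim k X = (\<Sum>u\<in>pverts G. adj_dim k (H u))"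
proof -
  \<comment> \<open>The operator is chosen per class, so that P1 and P2 become a single condition
    \<open>good\<close>, with a compatibility clause only for classes of twins.\<close>
  define N where
    "N C = (if \<exists>u\<in>true_twin_verts G. C = twin_class G u then non_nbhd
            else closed_nbhd :: 'b pair_pre_digraph \<Rightarrow> _)" for C
  define good where "good C A \<longleftrightarrow> (\<forall>i\<in>C. adj_basis k (H i) (A i)) \<and>
    (C \<in> twin_class G ` (true_twin_verts G \<union> false_twin_verts G) \<longrightarrow>
      (\<forall>j\<in>C. \<forall>l\<in>C. j \<noteq> l \<longrightarrow> (\<forall>x\<in>pverts (H j). \<forall>y\<in>pverts (H l).
         k \<le> card (({j} \<times> (A j \<inter> N C (H j) x)) \<union> ({l} \<times> (A l \<inter> N C (H l) y))))))" for C A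
  have ex: "\<exists>A. good (twin_class G u) A" if u: "u \<in> pverts G" for u
  proof (cases "\<exists>v\<in>true_twin_verts G. twin_class G u = twin_class G v")
    case True
    then show ?thesis
      using P1 by (auto simp: good_def N_def property_P1_def compatible_bases_def)
  next
    case noT: False
    show ?thesis
    proof (cases "\<exists>v\<in>false_twin_verts G. twin_class G u = twin_class G v")
      case True
      then show ?thesis
        using noT P2 by (auto simp: good_def N_def property_P2_def compatible_bases_def)
    next
      case False
      \<comment> \<open>The compatibility clause is vacuous for this class, so arbitrary bases will
        do.\<close>
      have "\<exists>A. adj_basis k (H i) A" if "i \<in> pverts G" for i
        using gen[OF that] adj_basis_exists by blast
      then obtain A where "\<And>i. i \<in> pverts G \<Longrightarrow> adj_basis k (H i) (A i)" by metis
      then show ?thesis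
        using noT False by (intro exI[of _ A]) (auto simp: good_def twin_rel_def)
    qed
  qed
  \<comment> \<open>One choice per twin class, so that the bases of different twins are compatible.\<close>
  define A where "A u = (SOME A. good (twin_class G u) A) u" for u
  have good_A: "good (twin_class G u) A" if u: "u \<in> pverts G" for u
  proof -
    let ?B = "SOME A. good (twin_class G u) A"
    have "A i = ?B i" if "i \<in> twin_class G u" for i
      using twin_class_eq[OF pair_graph_G, of u i] that by (simp add: A_def)
    moreover have "good (twin_class G u) ?B" using ex[OF u] by (rule someI_ex)
    ultimately show ?thesis by (simp add: good_def)
  qed
  have basis: "adj_basis k (H u) (A u)" if "u \<in> pverts G" for u
    using good_A[OF that] that by (auto simp: good_def twin_rel_def)
  have compat: "k \<le> card (({u} \<times> (A u \<inter> N (twin_class G u) (H u) x)) \<union>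
      ({u'} \<times> (A u' \<inter> N (twin_class G u) (H u') y)))"
    if "(u, u') \<in> twin_rel G" "u \<noteq> u'" "x \<in> pverts (H u)" "y \<in> pverts (H u')" for u u' x y
  proof -
    have u: "u \<in> pverts G" "u \<in> twin_class G u" "u' \<in> twin_class G u"
      using that(1) by (auto simp: twin_rel_def)
    have "u \<in> true_twin_verts G \<union> false_twin_verts G"
      using pair_graph_G that(1,2) by (cases rule: twin_verts_cases) auto
    then show ?thesis
      using good_A[OF u(1)] u that unfolding good_def by blast
  qed
  have N_true: "N (twin_class G u) = non_nbhd"
    if "true_twins G u u'" "(u, u') \<in> twin_rel G" for u u'
  proof -
    have "u \<noteq> u'" using that(1) by (simp add: true_twins_def)
    with pair_graph_G that(2) have "u \<in> true_twin_verts G"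
    proof (cases rule: twin_verts_cases)
      case false
      then show ?thesis
        using that(1) G.no_loops' by (auto simp: true_twins_def false_twins_def closed_nbhd_def nbhd_def)
    qed
    then show ?thesis by (auto simp: N_def)
  qed
  have N_false: "N (twin_class G u) = closed_nbhd"
    if "false_twins G u u'" "(u, u') \<in> twin_rel G" for u u'
  proof -
    \<comment> \<open>Being both would make \<open>u\<close> and \<open>u'\<close> adjacent and then
      force a loop. Hence this class is not the class of a true twin vertex, and \<open>N\<close>
      takes its second value.\<close>
    have "\<not> true_twins G u u'"
      using that(1) G.no_loops' by (auto simp: true_twins_def false_twins_def closed_nbhd_def nbhd_def)
    moreover have "u \<noteq> u'" using that(1) by (simp add: false_twins_def)
    moreover have "u \<in> twin_class G u" "u' \<in> twin_class G u" using that(2) by (auto simp: twin_rel_def)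
    ultimately have "\<not> pairwise (true_twins G) (twin_class G u)"
      by (meson pairwiseD)
    moreover have "v \<in> pverts G" if "v \<in> true_twin_verts G" for v
      using vertex_kinds_cover[OF pair_graph_G] that by blast
    ultimately have "\<not> (\<exists>v\<in>true_twin_verts G. twin_class G u = twin_class G v)"
      using true_twin_verts_iff[OF pair_graph_G] by metis
    then show ?thesis by (simp only: N_def if_False)
  qed
  let ?S = "SIGMA u:pverts G. A u"
  have S: "metric_generator k X ?S"
  proof (rule metric_generator_Sigma)
    show "adj_generator k (H u) (A u)" if "u \<in> pverts G" for u
      using basis[OF that] by (simp add: adj_basis_def)
  next
    fix u u' x y
    assume *: "true_twins G u u'" "(u, u') \<in> twin_rel G" "x \<in> pverts (H u)" "y \<in> pverts (H u')"
    then show "k \<le> card (({u} \<times> (A u \<inter> non_nbhd (H u) x)) \<union> ({u'} \<times> (A u' \<inter> non_nbhd (H u') y)))"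
      using compat[OF *(2) _ *(3,4)] N_true by (auto simp: true_twins_def)
  next
    fix u u' x y
    assume *: "false_twins G u u'" "(u, u') \<in> twin_rel G" "x \<in> pverts (H u)" "y \<in> pverts (H u')"
    then show "k \<le> card (({u} \<times> (A u \<inter> closed_nbhd (H u) x)) \<union> ({u'} \<times> (A u' \<inter> closed_nbhd (H u') y)))"
      using compat[OF *(2) _ *(3,4)] N_false by (auto simp: false_twins_def)
  qed
  have "finite (A u)" if "u \<in> pverts G" for u
    using basis[OF that] finite_H[OF that]
    by (auto simp: adj_basis_def adj_generator_def dest: finite_subset)
  then have "card ?S = (\<Sum>u\<in>pverts G. card (A u))"
    by (simp add: G.pair_finite_verts)
  also have "\<dots> = (\<Sum>u\<in>pverts G. adj_dim k (H u))"
    using basis by (simp add: adj_basis_def)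
  finally have "card ?S = (\<Sum>u\<in>pverts G. adj_dim k (H u))" .
  \<comment> \<open>The generator \<open>?S\<close> attains the lower bound, so the infimum is taken
    over a nonempty set and equals this value.\<close>
  then show ?thesis
    unfolding metric_dim_def
    using S sum_adj_dim_le by (intro cInf_eq_minimum) (auto simp: image_iff intro!: exI[of _ ?S])
qed

end

section \<open>Both identities, the second by passing to complements\<close>

theorem theorem13:
  fixes G :: "'a pair_pre_digraph" and H :: "'a \<Rightarrow> 'b pair_pre_digraph" and k :: nat
  assumes "pair_graph G" and "Digraph_Component.connected (with_proj G)"
    and "card (pverts G) \<ge> 2"
    and "\<And>u. u \<in> pverts G \<Longrightarrow> pair_graph (H u)"
    and "\<And>u. u \<in> pverts G \<Longrightarrow> card (pverts (H u)) \<ge> 2"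
    and "k \<in> {1..min (twin_bound G H) (adj_bound_family (pverts G) H)}"
  shows "(property_P1 G H k \<and> property_P2 G H k \<longrightarrow>
             metric_dim k (lex_product G H) = (\<Sum>u\<in>pverts G. adj_dim k (H u))) \<and>
         (property_P3 G H k \<and> property_P4 G H k \<longrightarrow>
             metric_dim k (lex_product G (\<lambda>u. gcomplement (H u))) =
               (\<Sum>u\<in>pverts G. adj_dim k (H u)))"
proof (intro conjI impI; elim conjE)
  interpret G: pair_graph G by fact
  interpret lex_family G H
    by (intro lex_family.intro assms(1,4,5) connected_imp_nbhd_nonempty[OF assms(1-3)])
  have gen: "adj_generator k (H u) (pverts (H u))" if u: "u \<in> pverts G" for u
  proof (rule adj_generator_pverts[OF assms(4)[OF u]])
    have "adj_bound_family (pverts G) H \<le> adj_bound (H u)"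
      unfolding adj_bound_family_def using u G.pair_finite_verts by (intro Min_le) auto
    then show "k \<le> adj_bound (H u)" using assms(6) by auto
  qed
  show "metric_dim k (lex_product G H) = (\<Sum>u\<in>pverts G. adj_dim k (H u))"
    if "property_P1 G H k" "property_P2 G H k"
    using gen that by (rule metric_dim_lex_product)
  show "metric_dim k (lex_product G (\<lambda>u. gcomplement (H u))) = (\<Sum>u\<in>pverts G. adj_dim k (H u))"
    if P3: "property_P3 G H k" and P4: "property_P4 G H k"
  proof -
    let ?H' = "\<lambda>u. gcomplement (H u)"
    interpret C: lex_family G ?H'
      by (intro lex_family.intro assms(1,4) connected_imp_nbhd_nonempty[OF assms(1-3)]
          pair_graph_gcomplement) (simp_all add: assms(5))
    have cls: "pair_graph (H v)" if "v \<in> twin_class G u" for u v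
      using that assms(4) by (auto simp: twin_rel_def)
    have "metric_dim k (lex_product G ?H') = (\<Sum>u\<in>pverts G. adj_dim k (?H' u))"
    proof (rule C.metric_dim_lex_product)
      show "adj_generator k (?H' u) (pverts (?H' u))" if "u \<in> pverts G" for u
        using gen[OF that] by (simp add: adj_generator_gcomplement[OF assms(4)[OF that]])
      \<comment> \<open>The twin classes depend only on \<open>G\<close>, so P3 for the family turns
        into P1 for the complements; P4 turns into P2 in the same way.\<close>
      show "property_P1 G ?H' k"
        unfolding property_P1_def
      proof
        fix u assume "u \<in> true_twin_verts G"
        then have "compatible_bases k H nbhd (twin_class G u)"
          using P3 by (simp only: property_P3_def)
        then show "compatible_bases k ?H' non_nbhd (twin_class G u)"
          by (rule compatible_bases_gcomplement)
            (erule cls, rule nbhd_subset_non_nbhd_gcomplement[OF cls], assumption+)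
      qed
      show "property_P2 G ?H' k"
        unfolding property_P2_def
      proof
        fix u assume "u \<in> false_twin_verts G"
        then have "compatible_bases k H non_nbhd (twin_class G u)"
          using P4 by (simp only: property_P4_def)
        then show "compatible_bases k ?H' closed_nbhd (twin_class G u)"
          by (rule compatible_bases_gcomplement)
            (erule cls, rule non_nbhd_subset_closed_nbhd_gcomplement, assumption)
      qed
    qed
    also have "\<dots> = (\<Sum>u\<in>pverts G. adj_dim k (H u))"
      by (intro sum.cong refl adj_dim_gcomplement assms(4))
    finally show ?thesis .
  qed
qed

end
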